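(* Let $k\geq 3$ be an integer and let $\varepsilon$ be a real number with $0<\varepsilon<\frac{2}{20(k^2+k)}$. For real $x$, let $$\mathcal{D}(x)=\{n\leq x : n=n_1\cdots n_k \text{ for some positive integers } n_1,\ldots,n_k \text{ with } \omega(n_i)>(1-\varepsilon)\log\log x \text{ for all } 1\leq i\leq k\}.$$ Then there is a constant $c(\varepsilon)>0$ such that for all sufficiently large $x$, $$|\mathcal{D}(x)|\leq c(\varepsilon)\frac{x}{(\log x)^{1+\delta}},$$ where $\delta=\log(2)\bigl(k-\varepsilon\frac{k^2+k}{2}\bigr)-2$, which satisfies $\delta>\log(2)(k-\tfrac{1}{10})-2>0$.
   Context: $\omega(n)$ denotes the number of distinct prime factors of $n$; $\log$ is the natural logarithm. *)

theory Defs
  imports Complex_Main "HOL-Computational_Algebra.Primes"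
begin

definition omega :: "nat \<Rightarrow> nat" where
  "omega n = card (prime_factors n)"

definition D_set :: "nat \<Rightarrow> real \<Rightarrow> real \<Rightarrow> nat set" where
  "D_set k \<epsilon> x = {n. real n \<le> x \<and>
     (\<exists>f :: nat \<Rightarrow> nat. n = (\<Prod>i\<in>{1..k}. f i) \<and>
        (\<forall>i\<in>{1..k}. f i > 0 \<and> real (omega (f i)) > (1 - \<epsilon>) * ln (ln x)))}"

definition delta :: "nat \<Rightarrow> real \<Rightarrow> real" where
  "delta k \<epsilon> = ln 2 * (real k - \<epsilon> * ((real k ^ 2 + real k) / 2)) - 2"

text \<open>The cardinality of \<^const>\<open>D_set\<close> is never the junk value of \<^const>\<open>card\<close> on infinite sets.\<close>

lemma finite_D_set: "finite (D_set k \<epsilon> x)"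
proof (rule finite_subset)
  show "D_set k \<epsilon> x \<subseteq> {..nat \<lfloor>x\<rfloor>}"
    by (auto simp: D_set_def le_nat_floor)
qed simp

end

theory Submission
  imports Defs
    "HOL-Computational_Algebra.Squarefree"
    "HOL-Analysis.Harmonic_Numbers"
    "HOL-Real_Asymp.Real_Asymp"
begin

text \<open>
  Write \<open>\<Omega>(n)\<close> for the number of prime factors of \<open>n\<close> with multiplicity. Since
  \<open>\<Omega>(n) = \<Sum>\<^sub>i \<Omega>(n\<^sub>i) \<ge> \<Sum>\<^sub>i \<omega>(n\<^sub>i)\<close>, every member of \<open>\<D>(x)\<close> has
  \<open>\<Omega>(n) \<ge> M := \<lceil>k (1 - \<epsilon>) log log x\<rceil>\<close>. At most \<open>x / 2\<^sup>M\<close> integers up to \<open>x\<close> are divisible by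
  \<open>2\<^sup>M\<^sup>+\<^sup>1\<close>; the others are counted with the weight \<open>2\<close> to the power \<open>\<Omega>(n) - M\<close>. To sum it, write
  \<open>n = 2\<^sup>a 3\<^sup>b t\<^sup>2 s\<close> with \<open>a \<le> M\<close>, \<open>t\<close> coprime to 6 and \<open>s\<close> squarefree. The weight of \<open>s\<close> is its
  number of divisors, which contributes \<open>y (1 + log y)\<close> over \<open>s \<le> y\<close>. The sum over \<open>t\<close> converges
  because \<open>5\<close> to the power \<open>\<Omega>(t)\<close> is at most \<open>t\<close>, the sum over \<open>b\<close> is geometric with ratio 2/3,
  and each \<open>a\<close> contributes 1. Hence there are \<open>O(x (M + 1) (1 + log x) / 2\<^sup>M)\<close> such integers, and
  the factor \<open>M + 1\<close>, of order \<open>log log x\<close>, is absorbed because \<open>k (k + 1) / 2 > k\<close>.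
\<close>

section \<open>Prime factors counted with multiplicity\<close>

definition total_omega :: "nat \<Rightarrow> nat" where
  "total_omega n = size (prime_factorization n)"

lemma total_omega_1 [simp]: "total_omega (Suc 0) = 0"
  by (simp add: total_omega_def)

lemma total_omega_mult: "m > 0 \<Longrightarrow> n > 0 \<Longrightarrow> total_omega (m * n) = total_omega m + total_omega n"
  by (simp add: total_omega_def prime_factorization_mult)

lemma total_omega_prime_power: "prime p \<Longrightarrow> total_omega (p ^ n) = n"
  by (simp add: total_omega_def prime_factorization_prime_power)

lemma total_omega_prod:
  "finite A \<Longrightarrow> (\<And>i. i \<in> A \<Longrightarrow> f i > 0) \<Longrightarrow> total_omega (\<Prod>i\<in>A. f i) = (\<Sum>i\<in>A. total_omega (f i))"
  by (induction A rule: finite_induct) (auto simp: total_omega_mult prod_pos)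

lemma omega_le_total_omega: "omega n \<le> total_omega n"
  unfolding omega_def total_omega_def size_multiset_overloaded_eq
  using sum_mono[of "prime_factors n" "\<lambda>_. 1" "count (prime_factorization n)"]
  by (auto simp: Suc_le_eq)

text \<open>\<open>n\<close> is a product of \<open>total_omega n\<close> primes, each at least
  \<open>q\<close>. The case \<open>q = 5\<close> serves for numbers coprime to 6.\<close>

lemma power_total_omega_le:
  fixes q :: nat
  assumes "n > 0" and "\<And>p. prime p \<Longrightarrow> p dvd n \<Longrightarrow> q \<le> p"
  shows "q ^ total_omega n \<le> n"
proof -
  have "q ^ size A \<le> prod_mset A" if "\<And>p. p \<in># A \<Longrightarrow> q \<le> p" for A :: "nat multiset"
    using that by (induction A) (auto intro: mult_le_mono)
  from this[of "prime_factorization n"] show ?thesis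
    using assms by (auto simp: total_omega_def in_prime_factors_iff)
qed

text \<open>Each set of prime factors of \<open>n\<close> multiplies to a divisor of
  \<open>n\<close>, and distinct sets give distinct divisors. For squarefree \<open>n\<close> there
  are 2 to the \<open>total_omega n\<close> such sets.\<close>

lemma squarefree_power_total_omega_le:
  assumes "squarefree n"
  shows "2 ^ total_omega n \<le> card {d. d dvd n}"
proof -
  have n: "n > 0" using assms by (cases n) auto
  have "prime_factorization n = mset_set (prime_factors n)"
    using assms n
    by (intro multiset_eqI)
       (auto simp: squarefree_factorial_semiring' count_prime_factorization_prime in_prime_factors_iff
        count_mset_set' count_prime_factorization not_dvd_imp_multiplicity_0)
  then have "total_omega n = card (prime_factors n)"
    unfolding total_omega_def by (metis size_mset_set)
  then have "2 ^ total_omega n = card (Pow (prime_factors n))"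
    by (simp add: card_Pow)
  also have "\<dots> \<le> card {d. d dvd n}"
  proof (rule card_inj_on_le)
    \<comment> \<open>By unique factorization \<open>prime_factors\<close> recovers \<open>P\<close>
      from its product; this is the left inverse used for injectivity.\<close>
    have pf: "prime_factors (\<Prod>P) = P" if "P \<subseteq> prime_factors n" for P
    proof -
      have "finite P" using that finite_subset by blast
      moreover have "prime_factorization (prod_mset (mset_set P)) = mset_set P"
        by (rule prime_factorization_prod_mset_primes)
           (use that \<open>finite P\<close> in auto)
      ultimately show ?thesis by (simp add: prod_unfold_prod_mset)
    qed
    then show "inj_on (\<lambda>P. \<Prod>P) (Pow (prime_factors n))"
      by (intro inj_on_inverseI[where g = prime_factors]) auto
    have "\<Prod>P dvd n" if "P \<subseteq> prime_factors n" for P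
    proof -
      have "\<Prod>P dvd \<Prod>(prime_factors n)"
        using that by (intro prod_dvd_prod_subset) auto
      also have "\<dots> dvd n"
        using \<open>prime_factorization n = _\<close> n
        by (metis dvd_refl prod_mset_prime_factorization_nat prod_unfold_prod_mset image_mset.identity id_def multiset.map_ident)
      finally show ?thesis .
    qed
    then show "(\<lambda>P. \<Prod>P) ` Pow (prime_factors n) \<subseteq> {d. d dvd n}" by auto
    show "finite {d. d dvd n}" using n by (intro finite_divisors_nat)
  qed
  finally show ?thesis .
qed

section \<open>Harmonic numbers and the average of the divisor function\<close>

lemma harm_le_ln: "n > 0 \<Longrightarrow> harm n \<le> 1 + ln (real n)"
proof -
  assume "n > 0"
  then obtain m where m: "n = Suc m" by (cases n) auto
  \<comment> \<open>\<open>harm n - ln n\<close> is decreasing and equals 1 at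
    \<open>n = 1\<close>.\<close>
  show ?thesis
    using decseqD[OF decseq_harm_diff_ln, of 0 m] by (simp add: m harm_expand)
qed

text \<open>Exchange of summation: the pair \<open>(n, d)\<close> with \<open>d dvd n\<close>
  becomes \<open>(d, n div d)\<close>, so each \<open>d\<close> is counted once per multiple up to
  \<open>N\<close>.\<close>

lemma sum_divisor_count_le:
  "(\<Sum>n\<in>{1..N}. real (card {d. d dvd n})) \<le> real N * harm N"
proof -
  have "(\<Sum>n\<in>{1..N}. real (card {d. d dvd n})) = real (card (SIGMA n:{1..N}. {d. d dvd n}))"
    by (subst card_SigmaI) (auto intro!: finite_divisors_nat)
  also have "card (SIGMA n:{1..N}. {d. d dvd n}) \<le> card (SIGMA d:{1..N}. {1..N div d})"
  proof (rule card_inj_on_le[where f = "\<lambda>(n, d). (d, n div d)"])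
    show "inj_on (\<lambda>(n, d). (d, n div d)) (SIGMA n:{1..N}. {d. d dvd n})"
      by (auto simp: inj_on_def)
    show "(\<lambda>(n, d). (d, n div d)) ` (SIGMA n:{1..N}. {d. d dvd n}) \<subseteq> (SIGMA d:{1..N}. {1..N div d})"
    proof clarify
      fix n d assume n: "n \<in> {1..N}" "d dvd n"
      then have "d > 0" "d \<le> n" by (auto simp: dvd_imp_le intro: dvd_pos_nat)
      moreover from this have "n div d > 0" by (simp add: div_greater_zero_iff)
      ultimately show "d \<in> {1..N} \<and> n div d \<in> {1..N div d}"
        using n by (auto simp: div_le_mono Suc_le_eq)
    qed
  qed auto
  also have "real (card (SIGMA d:{1..N}. {1..N div d})) = (\<Sum>d\<in>{1..N}. real (N div d))"
    by (subst card_SigmaI) auto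
  also have "\<dots> \<le> (\<Sum>d\<in>{1..N}. real N * inverse (real d))"
    by (intro sum_mono) (metis divide_inverse of_nat_div_le_of_nat)
  also have "\<dots> = real N * harm N"
    by (simp add: harm_def sum_distrib_left)
  finally show ?thesis by simp
qed

section \<open>Weighted sums, extended from squarefree numbers by one factor at a time\<close>

definition wsum :: "nat set \<Rightarrow> real \<Rightarrow> real" where
  "wsum A y = (\<Sum>n | n \<in> A \<and> real n \<le> y. 2 ^ total_omega n)"

lemma finite_nat_le_real: "finite {n. P n \<and> real n \<le> y}"
  by (rule finite_subset[of _ "{..nat \<lfloor>y\<rfloor>}"]) (auto simp: le_nat_floor)

text \<open>The weight is dominated by the divisor function. Using \<open>ln x\<close> with a fixed
  \<open>x \<ge> y\<close> keeps the bound linear in \<open>y\<close>, which is the form of the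
  hypothesis on \<open>C\<close> in \<open>wsum_product_le\<close>.\<close>

lemma wsum_squarefree_le:
  assumes "0 \<le> y" "y \<le> x" "1 \<le> x"
  shows "wsum {n. squarefree n} y \<le> (1 + ln x) * y"
proof (cases "y < 1")
  case True
  have "y < real n" if "squarefree n" for n
    using that True by (cases n) auto
  then have *: "{n. n \<in> {n. squarefree n} \<and> real n \<le> y} = {}"
    by (auto simp: not_le)
  have "wsum {n. squarefree n} y = 0"
    unfolding wsum_def * by simp
  with assms show ?thesis by simp
next
  case False
  define N where "N = nat \<lfloor>y\<rfloor>"
  have N: "N > 0" "real N \<le> y" using False by (auto simp: N_def)
  have "wsum {n. squarefree n} y \<le> (\<Sum>n | squarefree n \<and> real n \<le> y. real (card {d. d dvd n}))"
    unfolding wsum_def mem_Collect_eq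
    by (intro sum_mono) (metis (mono_tags) squarefree_power_total_omega_le mem_Collect_eq of_nat_le_iff of_nat_numeral of_nat_power)
  also have "\<dots> \<le> (\<Sum>n\<in>{1..N}. real (card {d. d dvd n}))"
    by (intro sum_mono2) (auto simp: N_def le_nat_floor Suc_le_eq intro!: Nat.gr0I)
  also have "\<dots> \<le> real N * harm N" by (rule sum_divisor_count_le)
  also have "\<dots> \<le> y * (1 + ln x)"
    using N harm_le_ln[of N] assms
    by (intro mult_mono) (auto intro!: harm_nonneg order.trans[OF harm_le_ln])
  finally show ?thesis by (simp add: mult.commute)
qed

text \<open>The weight is completely multiplicative, so the terms \<open>g i * c\<close> contribute
  the weight of \<open>g i\<close> times \<open>wsum C (y / g i)\<close>. Linearity of the bound for
  \<open>C\<close> turns this into a sum of weight over size, bounded by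
  \<open>\<beta>\<close>.\<close>

lemma wsum_product_le:
  fixes g :: "'i \<Rightarrow> nat"
  assumes fin: "finite I"
    and A: "\<And>n. n \<in> A \<Longrightarrow> real n \<le> x \<Longrightarrow> \<exists>i\<in>I. \<exists>c\<in>C. n = g i * c"
    and pos: "\<And>i. i \<in> I \<Longrightarrow> g i > 0" "0 \<notin> C"
    and C: "\<And>y. 0 \<le> y \<Longrightarrow> y \<le> x \<Longrightarrow> wsum C y \<le> \<kappa> * y"
    and \<beta>: "(\<Sum>i\<in>I. 2 ^ total_omega (g i) / real (g i)) \<le> \<beta>"
    and y: "0 \<le> y" "y \<le> x" and \<kappa>: "\<kappa> \<ge> 0"
  shows "wsum A y \<le> \<kappa> * \<beta> * y"
proof -
  let ?S = "SIGMA i:I. {c. c \<in> C \<and> real c \<le> y / real (g i)}"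
  have finS: "finite ?S" using fin finite_nat_le_real by (intro finite_SigmaI) auto
  have "wsum A y \<le> (\<Sum>n\<in>(\<lambda>(i, c). g i * c) ` ?S. 2 ^ total_omega n)"
    unfolding wsum_def
  proof (rule sum_mono2)
    show "{n. n \<in> A \<and> real n \<le> y} \<subseteq> (\<lambda>(i, c). g i * c) ` ?S"
    proof safe
      fix n assume n: "n \<in> A" "real n \<le> y"
      then obtain i c where "i \<in> I" "c \<in> C" "n = g i * c" using A[of n] y by auto
      moreover from this have "real c \<le> y / real (g i)"
        using n pos(1)[of i] by (simp add: field_simps)
      ultimately show "n \<in> (\<lambda>(i, c). g i * c) ` ?S" by force
    qed
  qed (use finS in auto)
  \<comment> \<open>A number may arise from several pairs \<open>(i, c)\<close>; as weights are
    nonnegative, repetition only enlarges the sum.\<close>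
  also have "\<dots> \<le> (\<Sum>(i, c)\<in>?S. 2 ^ total_omega (g i * c))"
    using sum_image_le[OF finS, of "\<lambda>n. 2 ^ total_omega n :: real" "\<lambda>(i, c). g i * c"]
    by (simp add: case_prod_unfold o_def)
  also have "\<dots> = (\<Sum>(i, c)\<in>?S. 2 ^ total_omega (g i) * 2 ^ total_omega c)"
    proof (intro sum.cong refl, clarify)
    fix i c assume "i \<in> I" "c \<in> C"
    moreover from this have "c > 0" using pos(2) by (metis gr0I)
    ultimately show "2 ^ total_omega (g i * c) = (2 ^ total_omega (g i) * 2 ^ total_omega c :: real)"
      using pos(1) by (simp add: total_omega_mult power_add)
  qed
  also have "\<dots> = (\<Sum>i\<in>I. 2 ^ total_omega (g i) * wsum C (y / real (g i)))"
    using fin finite_nat_le_real by (subst sum.Sigma[symmetric]) (auto simp: wsum_def sum_distrib_left)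
  also have "\<dots> \<le> (\<Sum>i\<in>I. 2 ^ total_omega (g i) * (\<kappa> * (y / real (g i))))"
  proof (intro sum_mono mult_left_mono C)
    fix i assume "i \<in> I"
    then have "1 \<le> real (g i)" using pos(1)[of i] by simp
    then have "y / real (g i) \<le> y" using y by (simp add: divide_le_eq mult_le_cancel_left1)
    then show "y / real (g i) \<le> x" using y by simp
  qed (use y in auto)
  also have "\<dots> = \<kappa> * y * (\<Sum>i\<in>I. 2 ^ total_omega (g i) / real (g i))"
    by (simp add: sum_distrib_left mult_ac)
  also have "\<dots> \<le> \<kappa> * y * \<beta>"
    using y \<kappa> \<beta> by (intro mult_left_mono) auto
  finally show ?thesis by (simp add: mult_ac)
qed

lemma summable_weighted_squares_coprime_6:
  obtains S where "S > 0"
    "\<And>T. finite T \<Longrightarrow> (\<And>t. t \<in> T \<Longrightarrow> t > 0 \<and> coprime t 6) \<Longrightarrow>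
      (\<Sum>t\<in>T. 2 ^ total_omega (t ^ 2) / real (t ^ 2)) \<le> S"
proof
  \<comment> \<open>With \<open>5 powr \<theta> = 4\<close>, the bound of 5 to the
    \<open>total_omega t\<close> by \<open>t\<close> makes the weight of \<open>t ^ 2\<close> at
    most \<open>t powr \<theta>\<close>. The series converges since
    \<open>\<theta> - 2 < -1\<close>. The prime 3 is kept out because the same argument with base 3
    would give an exponent above 1.\<close>
  define \<theta> :: real where "\<theta> = log 5 4"
  have \<theta>: "\<theta> < 1" by (simp add: \<theta>_def)
  let ?f = "\<lambda>n::nat. real n powr (\<theta> - 2)"
  have summ: "summable ?f" using \<theta> by (subst summable_real_powr_iff) simp
  have "?f 1 \<le> suminf ?f"
    using sum_le_suminf[OF summ, of "{1}"] by simp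
  then show "suminf ?f > 0" by simp
  fix T :: "nat set" assume T: "finite T" "\<And>t. t \<in> T \<Longrightarrow> t > 0 \<and> coprime t 6"
  have "2 ^ total_omega (t ^ 2) / real (t ^ 2) \<le> ?f t" if "t \<in> T" for t
  proof -
    have t: "t > 0" "coprime t 6" using T that by auto
    have "5 \<le> p" if "prime p" "p dvd t" for p
    proof (rule ccontr)
      assume "\<not> 5 \<le> p"
      then have "p \<in> {0, 1, 2, 3, 4}" by auto
      moreover have "\<not> prime (4 :: nat)" using prime_nat_iff[of 4] by (auto intro!: exI[of _ 2])
      ultimately have "p = 2 \<or> p = 3" using \<open>prime p\<close> by auto
      then have "p dvd 6" by auto
      with that t show False
        using not_coprimeI[of p t 6] prime_nat_iff by auto
    qed
    then have "5 ^ total_omega t \<le> t" using t power_total_omega_le by blast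
    then have "real (5 ^ total_omega t) \<le> real t" by (simp only: of_nat_le_iff)
    then have le: "(5 ^ total_omega t :: real) \<le> real t" by simp
    have "(2::real) ^ total_omega (t ^ 2) = 4 ^ total_omega t"
      using t by (simp add: total_omega_mult power2_eq_square power_add flip: power_mult_distrib)
    also have "\<dots> = (5 powr \<theta>) ^ total_omega t" by (simp add: \<theta>_def)
    also have "\<dots> = (5 ^ total_omega t) powr \<theta>"
      by (simp add: powr_powr powr_realpow[symmetric] mult.commute)
    also have "\<dots> \<le> real t powr \<theta>"
      using le by (intro powr_mono2) (auto simp: \<theta>_def)
    finally have "2 ^ total_omega (t ^ 2) / real (t ^ 2) \<le> real t powr \<theta> / real (t ^ 2)"
      by (intro divide_right_mono) auto
    also have "\<dots> = ?f t"
      using t by (simp add: powr_diff)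
    finally show ?thesis .
  qed
  then have "(\<Sum>t\<in>T. 2 ^ total_omega (t ^ 2) / real (t ^ 2)) \<le> sum ?f T" by (rule sum_mono)
  also have "\<dots> \<le> suminf ?f" using summ T by (intro sum_le_suminf) auto
  finally show "(\<Sum>t\<in>T. 2 ^ total_omega (t ^ 2) / real (t ^ 2)) \<le> suminf ?f" .
qed

text \<open>Three applications of \<open>wsum_product_le\<close>: squares times squarefree numbers,
  then powers of 3, then powers of 2. Each output is again linear in \<open>y\<close> and feeds the
  next.\<close>

lemma wsum_not_dvd_power_2_le:
  obtains C where "C > 0"
    "\<And>M x. 1 \<le> x \<Longrightarrow> wsum {n. \<not> 2 ^ Suc M dvd n} x \<le> C * (1 + real M) * (1 + ln x) * x"
proof -
  obtain S where S: "S > 0" and S_le: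
    "\<And>T. finite T \<Longrightarrow> (\<And>t. t \<in> T \<Longrightarrow> t > 0 \<and> coprime t 6) \<Longrightarrow>
      (\<Sum>t\<in>T. 2 ^ total_omega (t ^ 2) / real (t ^ 2)) \<le> S"
    by (rule summable_weighted_squares_coprime_6, rule that; blast)
  show ?thesis
  proof
    show "3 * S > 0" using S by simp
    fix M :: nat and x :: real assume x: "1 \<le> x"
    define N where "N = nat \<lfloor>x\<rfloor>"
    have ln: "1 + ln x \<ge> 0" using x by (simp add: add_nonneg_nonneg)
    have coprime_6: "wsum {n. coprime n 6} y \<le> (1 + ln x) * S * y" if "0 \<le> y" "y \<le> x" for y
    proof (rule wsum_product_le[where C = "{n. squarefree n}" and x = x
          and I = "{t. 0 < t \<and> t \<le> N \<and> coprime t 6}" and g = "\<lambda>t. t ^ 2"])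
      fix n assume n: "n \<in> {n. coprime n 6}" "real n \<le> x"
      then have n0: "n > 0" by (auto intro!: Nat.gr0I)
      let ?t = "square_part n"
      have dec: "n = ?t ^ 2 * squarefree_part n"
        using squarefree_decompose[of n] by (simp add: mult.commute)
      have "?t dvd n" using square_part_square_dvd[of n] by (metis dvd_mult_left power2_eq_square)
      moreover from this have "?t \<le> n" using n0 by (rule dvd_imp_le)
      moreover have "coprime ?t 6" using \<open>?t dvd n\<close> n by (auto intro: coprime_divisors[of _ n _ 6])
      moreover have "squarefree (squarefree_part n)"
        by (auto simp: squarefree_factorial_semiring'')
      moreover have "?t > 0" using n0 by (metis gr0I less_irrefl square_part_0_iff)
      moreover have "?t \<le> N" using \<open>?t \<le> n\<close> n unfolding N_def by (simp add: le_nat_floor)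
      ultimately show "\<exists>i\<in>{t. 0 < t \<and> t \<le> N \<and> coprime t 6}. \<exists>c\<in>{n. squarefree n}. n = i ^ 2 * c"
        using dec by blast
    next
      show "(\<Sum>t | 0 < t \<and> t \<le> N \<and> coprime t 6. 2 ^ total_omega (t ^ 2) / real (t ^ 2)) \<le> S"
        by (rule S_le) auto
    qed (use that x ln wsum_squarefree_le in simp_all)
    have odd: "wsum {n. odd n} y \<le> (1 + ln x) * S * 3 * y" if "0 \<le> y" "y \<le> x" for y
    proof (rule wsum_product_le[where C = "{n. coprime n 6}" and x = x
          and I = "{..N}" and g = "\<lambda>b. 3 ^ b"])
      fix n assume n: "n \<in> {n. odd n}" "real n \<le> x"
      then have n0: "n > 0" by (auto intro!: Nat.gr0I)
      obtain m where m: "n = 3 ^ multiplicity 3 n * m" "\<not> 3 dvd m"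
        using multiplicity_decompose'[of n 3] n0 by auto
      have "coprime m 2" using m n by (metis coprime_right_2_iff_odd even_mult_iff mem_Collect_eq)
      moreover have "coprime m 3" 
        using m prime_imp_coprime[of 3 m] by (simp add: coprime_commute)
      ultimately have "coprime m (2 * 3)" by (simp only: coprime_mult_right_iff)
      \<comment> \<open>This crude bound only places the exponent in the finite index set
        \<open>{..N}\<close>; the geometric sum is bounded independently of
        \<open>N\<close>.\<close>
      moreover have "multiplicity 3 n \<le> n"
      proof -
        have "multiplicity 3 n < 3 ^ multiplicity 3 n" by (rule power_gt_expt) simp
        also have "\<dots> \<le> n" using n0 by (intro dvd_imp_le multiplicity_dvd)
        finally show ?thesis by simp
      qed
      ultimately show "\<exists>i\<in>{..N}. \<exists>c\<in>{n. coprime n 6}. n = 3 ^ i * c"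
        using m n by (intro bexI[of _ "multiplicity 3 n"] bexI[of _ m]) (auto simp: N_def le_nat_floor)
    next
      have "(\<Sum>i\<in>{..N}. 2 ^ total_omega (3 ^ i) / real (3 ^ i)) = (\<Sum>i\<in>{..N}. (2 / 3 :: real) ^ i)"
        by (simp add: total_omega_prime_power power_divide)
      also have "\<dots> \<le> (\<Sum>i. (2 / 3 :: real) ^ i)"
        by (intro sum_le_suminf) auto
      also have "\<dots> = 3" by (subst suminf_geometric) auto
      finally show "(\<Sum>i\<in>{..N}. 2 ^ total_omega (3 ^ i) / real (3 ^ i)) \<le> 3" .
    qed (use that coprime_6 ln S in auto)
    \<comment> \<open>At the prime 2 the weight cancels the size, so every exponent contributes 1
      and the series would diverge; truncation at \<open>M\<close> leaves
      \<open>1 + M\<close>.\<close>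
    have "wsum {n. \<not> 2 ^ Suc M dvd n} x \<le> (1 + ln x) * S * 3 * (1 + real M) * x"
    proof (rule wsum_product_le[where C = "{n. odd n}" and x = x
          and I = "{..M}" and g = "\<lambda>b. 2 ^ b"])
      fix n assume n: "n \<in> {n. \<not> 2 ^ Suc M dvd n}" "real n \<le> x"
      then have n0: "n > 0" by (auto intro!: Nat.gr0I)
      obtain m where m: "n = 2 ^ multiplicity 2 n * m" "odd m"
        using multiplicity_decompose'[of n 2] n0 by auto
      have "multiplicity 2 n < Suc M"
        using n n0 by (auto intro: multiplicity_lessI)
      then show "\<exists>i\<in>{..M}. \<exists>c\<in>{n. odd n}. n = 2 ^ i * c"
        using m by (intro bexI[of _ "multiplicity 2 n"] bexI[of _ m]) auto
    qed (use odd x ln S in \<open>auto simp: total_omega_prime_power\<close>)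
    then show "wsum {n. \<not> 2 ^ Suc M dvd n} x \<le> 3 * S * (1 + real M) * (1 + ln x) * x"
      by (simp only: mult_ac)
  qed
qed


section \<open>Integers with many prime factors\<close>

lemma card_total_omega_ge:
  obtains C where "C > 0"
    "\<And>M x. 1 \<le> x \<Longrightarrow> real (card {n. (0 < n \<and> M \<le> total_omega n) \<and> real n \<le> x}) \<le>
       x * (1 + C * (1 + real M) * (1 + ln x)) / 2 ^ M"
proof -
  obtain C where C: "C > 0" and C_le:
    "\<And>M x. 1 \<le> x \<Longrightarrow> wsum {n. \<not> 2 ^ Suc M dvd n} x \<le> C * (1 + real M) * (1 + ln x) * x"
    by (rule wsum_not_dvd_power_2_le, rule that; blast)
  show ?thesis
  proof (rule that[OF C])
    fix M :: nat and x :: real assume x: "1 \<le> x"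
    \<comment> \<open>Multiples of the excluded power of 2, the set \<open>?A\<close>, are counted
      directly; the weighted bound handles the rest, \<open>?B\<close>.\<close>
    let ?A = "{n. (0 < n \<and> 2 ^ Suc M dvd n) \<and> real n \<le> x}"
    let ?B = "{n. (\<not> 2 ^ Suc M dvd n \<and> M \<le> total_omega n) \<and> real n \<le> x}"
    have "card {n. (0 < n \<and> M \<le> total_omega n) \<and> real n \<le> x} \<le> card (?A \<union> ?B)"
      by (rule card_mono) (use finite_nat_le_real in auto)
    also have "\<dots> \<le> card ?A + card ?B" by (rule card_Un_le)
    finally have *: "real (card {n. (0 < n \<and> M \<le> total_omega n) \<and> real n \<le> x}) \<le> real (card ?A) + real (card ?B)"
      by linarith
    have "card ?A \<le> card {1..nat \<lfloor>x / 2 ^ Suc M\<rfloor>}"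
    proof (rule card_inj_on_le[where f = "\<lambda>n. n div 2 ^ Suc M"])
      show "inj_on (\<lambda>n. n div 2 ^ Suc M) ?A"
        by (auto simp: inj_on_def elim!: dvdE)
      show "(\<lambda>n. n div 2 ^ Suc M) ` ?A \<subseteq> {1..nat \<lfloor>x / 2 ^ Suc M\<rfloor>}"
      proof clarify
        fix n assume n: "0 < n" "2 ^ Suc M dvd n" "real n \<le> x"
        then obtain m where m: "n = 2 ^ Suc M * m" by (elim dvdE)
        then have "real m \<le> x / 2 ^ Suc M" using n by (simp add: field_simps)
        then show "n div 2 ^ Suc M \<in> {1..nat \<lfloor>x / 2 ^ Suc M\<rfloor>}"
          using m n by (auto simp: le_nat_floor)
      qed
    qed simp
    then have "real (card ?A) \<le> real (nat \<lfloor>x / 2 ^ Suc M\<rfloor>)" by simp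
    also have "\<dots> \<le> x / 2 ^ Suc M" using x by (intro of_nat_floor) auto
    also have "\<dots> \<le> x / 2 ^ M" using x by (intro divide_left_mono) auto
    finally have A: "real (card ?A) \<le> x / 2 ^ M" .
    \<comment> \<open>Rankin's trick: every element of \<open>?B\<close> has weight at least
      \<open>2 ^ M\<close>.\<close>
    have "2 ^ M * real (card ?B) = (\<Sum>n\<in>?B. 2 ^ M)" by simp
    also have "\<dots> \<le> (\<Sum>n\<in>?B. 2 ^ total_omega n)" by (intro sum_mono power_increasing) auto
    also have "\<dots> \<le> wsum {n. \<not> 2 ^ Suc M dvd n} x"
      unfolding wsum_def by (rule sum_mono2[OF finite_nat_le_real]) auto
    also have "\<dots> \<le> C * (1 + real M) * (1 + ln x) * x" by (rule C_le[OF x])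
    finally have "real (card ?B) \<le> C * (1 + real M) * (1 + ln x) * x / 2 ^ M"
      by (simp add: field_simps)
    with * A show "real (card {n. (0 < n \<and> M \<le> total_omega n) \<and> real n \<le> x}) \<le>
       x * (1 + C * (1 + real M) * (1 + ln x)) / 2 ^ M"
      by (simp add: add_divide_distrib distrib_left mult_ac)
  qed
qed

section \<open>Application to \<open>D_set\<close>\<close>

lemma D_set_subset_total_omega:
  assumes "k \<ge> 1"
  shows "D_set k \<epsilon> x \<subseteq>
    {n. (0 < n \<and> nat \<lceil>real k * (1 - \<epsilon>) * ln (ln x)\<rceil> \<le> total_omega n) \<and> real n \<le> x}"
proof
  fix n assume "n \<in> D_set k \<epsilon> x"
  then obtain f where f: "real n \<le> x" "n = (\<Prod>i\<in>{1..k}. f i)" "\<And>i. i \<in> {1..k} \<Longrightarrow> f i > 0"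
    "\<And>i. i \<in> {1..k} \<Longrightarrow> (1 - \<epsilon>) * ln (ln x) < real (omega (f i))"
    unfolding D_set_def by blast
  have "real k * (1 - \<epsilon>) * ln (ln x) = (\<Sum>i\<in>{1..k}. (1 - \<epsilon>) * ln (ln x))" by simp
  also have "\<dots> \<le> (\<Sum>i\<in>{1..k}. real (total_omega (f i)))"
    using f(4) omega_le_total_omega
    by (intro sum_mono) (meson of_nat_le_iff less_imp_le order_trans)
  also have "\<dots> = real (total_omega n)"
    unfolding f(2) using f(3) by (subst total_omega_prod) auto
  \<comment> \<open>The right side is a natural number, so the bound survives rounding up, and a
    negative left side becomes 0 under \<open>nat\<close>.\<close>
  finally have "nat \<lceil>real k * (1 - \<epsilon>) * ln (ln x)\<rceil> \<le> total_omega n" by linarith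
  moreover have "n > 0" using f by (auto intro: prod_pos)
  ultimately show "n \<in> {n. (0 < n \<and> nat \<lceil>real k * (1 - \<epsilon>) * ln (ln x)\<rceil> \<le> total_omega n) \<and> real n \<le> x}"
    using f by simp
qed

text \<open>Dividing by \<open>2 ^ M\<close> saves the power
  \<open>ln 2 * (k * (1 - \<epsilon>))\<close> of \<open>ln x\<close>. The remaining loss is of
  order \<open>ln x * ln (ln x)\<close>, and any \<open>\<eta> > 0\<close> absorbs both its iterated
  logarithm and the constant \<open>C\<close>.\<close>

lemma card_D_set_bound:
  assumes "k \<ge> 1" and \<epsilon>: "\<epsilon> < 1" and \<eta>: "\<eta> > 0"
  shows "\<forall>\<^sub>F x::real in at_top.
    real (card (D_set k \<epsilon> x)) \<le> x * ln x powr (1 + \<eta> - ln 2 * (real k * (1 - \<epsilon>)))"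
proof -
  obtain C where C: "C > 0" and C_le:
    "\<And>M x. 1 \<le> x \<Longrightarrow> real (card {n. (0 < n \<and> M \<le> total_omega n) \<and> real n \<le> x}) \<le>
       x * (1 + C * (1 + real M) * (1 + ln x)) / 2 ^ M"
    by (rule card_total_omega_ge, rule that; blast)
  define \<kappa> where "\<kappa> = real k * (1 - \<epsilon>)"
  have \<kappa>: "\<kappa> > 0" using assms by (simp add: \<kappa>_def)
  \<comment> \<open>Here \<open>y\<close> stands for \<open>ln x\<close>; the 2 is the 1 in
    \<open>1 + M\<close> plus 1 for rounding \<open>M\<close> up.\<close>
  have "\<forall>\<^sub>F y::real in at_top. 1 + C * (2 + \<kappa> * ln y) * (1 + y) \<le> y powr (1 + \<eta>)"
    using C \<kappa> \<eta> by real_asymp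
  then have "\<forall>\<^sub>F x::real in at_top. 1 + C * (2 + \<kappa> * ln (ln x)) * (1 + ln x) \<le> ln x powr (1 + \<eta>)"
    by (rule eventually_compose_filterlim[OF _ ln_at_top])
  moreover have "\<forall>\<^sub>F x::real in at_top. ln (ln x) > 0" by real_asymp
  moreover have "\<forall>\<^sub>F x::real in at_top. ln x > 0" by real_asymp
  ultimately show ?thesis
    using eventually_ge_at_top[of 1]
  proof eventually_elim
    case (elim x)
    define M where "M = nat \<lceil>\<kappa> * ln (ln x)\<rceil>"
    have M: "\<kappa> * ln (ln x) \<le> real M" "real M \<le> \<kappa> * ln (ln x) + 1"
      using \<kappa> elim mult_pos_pos[of \<kappa> "ln (ln x)"] unfolding M_def by linarith+
    have "ln x powr (ln 2 * \<kappa>) = 2 powr (\<kappa> * ln (ln x))"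
      using elim by (simp add: powr_def mult_ac)
    also have "\<dots> \<le> 2 powr real M" using M by (intro powr_mono) auto
    also have "\<dots> = 2 ^ M" by (simp add: powr_realpow)
    finally have pow: "ln x powr (ln 2 * \<kappa>) \<le> 2 ^ M" .
    have "real (card (D_set k \<epsilon> x)) \<le> real (card {n. (0 < n \<and> M \<le> total_omega n) \<and> real n \<le> x})"
      using D_set_subset_total_omega[OF assms(1), of \<epsilon> x] finite_nat_le_real
      unfolding M_def \<kappa>_def by (intro of_nat_mono card_mono)
    also have "\<dots> \<le> x * (1 + C * (1 + real M) * (1 + ln x)) / 2 ^ M"
      using elim by (intro C_le)
    also have "\<dots> \<le> x * ln x powr (1 + \<eta>) / ln x powr (ln 2 * \<kappa>)"
    proof (rule frac_le)
      have "1 + C * (1 + real M) * (1 + ln x) \<le> 1 + C * (2 + \<kappa> * ln (ln x)) * (1 + ln x)"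
        using C elim M by (intro add_left_mono mult_right_mono mult_left_mono) auto
      also have "\<dots> \<le> ln x powr (1 + \<eta>)" using elim by simp
      finally show "x * (1 + C * (1 + real M) * (1 + ln x)) \<le> x * ln x powr (1 + \<eta>)"
        using elim by (intro mult_left_mono) auto
    qed (use elim pow in auto)
    finally show ?case using elim by (simp add: powr_diff \<kappa>_def)
  qed
qed

text \<open>Equivalent to \<open>2 < ln 2 * (3 - 1 / 10)\<close>, the extreme case
  \<open>k = 3\<close> of the last claim of the theorem.\<close>

lemma ln_2_gt_20_over_29: "ln (2::real) > 20 / 29"
  using ln_approx_bounds[of 2 2] by (simp add: eval_nat_numeral)

theorem theorem2p3:
  fixes k :: nat and \<epsilon> :: real
  assumes "k \<ge> 3"
    and "0 < \<epsilon>"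
    and "\<epsilon> < 2 / (20 * (real k ^ 2 + real k))"
  shows "(\<exists>c::real. c > 0 \<and>
            (\<forall>\<^sub>F x::real in at_top.
               real (card (D_set k \<epsilon> x)) \<le> c * (x / (ln x) powr (1 + delta k \<epsilon>)))) \<and>
         delta k \<epsilon> > ln 2 * (real k - 1 / 10) - 2 \<and>
         ln 2 * (real k - 1 / 10) - 2 > 0"
proof (intro conjI)
  have k: "real k \<ge> 3" using assms(1) by simp
  then have k2: "real k ^ 2 \<ge> 3 * real k" by (simp add: power2_eq_square)
  have \<epsilon>: "\<epsilon> * ((real k ^ 2 + real k) / 2) < 1 / 20"
    using assms k k2 by (simp add: field_simps)
  have "\<epsilon> * 1 \<le> \<epsilon> * ((real k ^ 2 + real k) / 2)"
    using assms(2) k k2 by (intro mult_left_mono) auto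
  with \<epsilon> have \<epsilon>1: "\<epsilon> < 1" by simp
  \<comment> \<open>The slack between the required loss \<open>\<epsilon> * (k ^ 2 + k) / 2\<close>
    and the actual loss \<open>\<epsilon> * k\<close>, times \<open>ln 2\<close>.\<close>
  define \<eta> where "\<eta> = ln 2 * (\<epsilon> * ((real k ^ 2 - real k) / 2))"
  have "real k ^ 2 - real k > 0" using k k2 by linarith
  then have \<eta>: "\<eta> > 0" using assms(2) by (simp add: \<eta>_def)
  have exponent: "1 + \<eta> - ln 2 * (real k * (1 - \<epsilon>)) = - (1 + delta k \<epsilon>)"
    by (simp add: \<eta>_def delta_def field_simps)
  have "\<forall>\<^sub>F x::real in at_top. real (card (D_set k \<epsilon> x)) \<le> x * ln x powr - (1 + delta k \<epsilon>)"
    using card_D_set_bound[OF _ \<epsilon>1 \<eta>, of k] assms(1) unfolding exponent by simp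
  then show "\<exists>c::real. c > 0 \<and>
      (\<forall>\<^sub>F x::real in at_top. real (card (D_set k \<epsilon> x)) \<le> c * (x / (ln x) powr (1 + delta k \<epsilon>)))"
    \<comment> \<open>The constant 1 suffices, since \<open>\<eta>\<close> has already absorbed all
      constants for large \<open>x\<close>.\<close>
    unfolding powr_minus_divide by (intro exI[of _ 1]) simp
  have "ln 2 * (real k - 1 / 10) < ln 2 * (real k - \<epsilon> * ((real k ^ 2 + real k) / 2))"
    using \<epsilon> by (intro mult_strict_left_mono) auto
  then show "delta k \<epsilon> > ln 2 * (real k - 1 / 10) - 2" by (simp add: delta_def)
  have "2 < ln 2 * (29 / 10 :: real)" using ln_2_gt_20_over_29 by simp
  also have "\<dots> \<le> ln 2 * (real k - 1 / 10)" using k by (intro mult_left_mono) auto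
  finally show "ln 2 * (real k - 1 / 10) - 2 > 0" by simp
qed

end
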